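(* Let $b=3^u(3^v+1)$ with integers $u>0$ and $v\ge 0$. Then the polynomial $f_b(x)=1+x^b+(-1)^b(x+1)^b$ is irreducible in $\mathbb{Q}[x]$. Moreover, for every integer $a$ with $1<a<b$, setting $A=\{1,a,b\}$, the set $p_A(3)=\{p_1(3),p_a(3),p_b(3)\}$ is a regular sequence in $R_3=\mathbb{C}[x_1,x_2,x_3]$ if and only if $ab\equiv 0\pmod 6$.
   Context: For $k\ge 1$, $p_k(3)=x_1^k+x_2^k+x_3^k\in R_3=\mathbb{C}[x_1,x_2,x_3]$ is the power sum of degree $k$ in three variables. A set of three homogeneous polynomials (of positive degree) in $R_3$ is a regular sequence if and only if their only common zero in $\mathbb{C}^3$ is $(0,0,0)$. *)

theory Defs
  imports
    "HOL-Computational_Algebra.Computational_Algebra"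
    "HOL-Number_Theory.Cong"
    Complex_Main
begin

definition ideal_generated :: "'a::comm_ring_1 set \<Rightarrow> 'a set" where
  "ideal_generated S = module.span (*) S"

text \<open>The locale premise under which the theory of \<^const>\<open>module.span\<close> applies here.\<close>

lemma module_times: "module ((*) :: 'a::comm_ring_1 \<Rightarrow> 'a \<Rightarrow> 'a)"
  by unfold_locales (simp_all add: algebra_simps)

text \<open>
  The usual notion, including properness of the ideal: each \<open>f\<^sub>i\<close> is a nonzerodivisor modulo
  \<open>(f\<^sub>1, \<dots>, f\<^sub>i\<^sub>-\<^sub>1)\<close>. For homogeneous polynomials of positive degree it does not depend on the
  order of the elements, so that one may speak of a set of such polynomials being a regular
  sequence.
\<close>

definition regular_sequence :: "'a::comm_ring_1 list \<Rightarrow> bool" where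
  "regular_sequence fs \<longleftrightarrow>
     ideal_generated (set fs) \<noteq> UNIV \<and>
     (\<forall>i < length fs. \<forall>g. g * fs ! i \<in> ideal_generated (set (take i fs)) \<longrightarrow>
        g \<in> ideal_generated (set (take i fs)))"

text \<open>\<open>\<complex>[x\<^sub>1, x\<^sub>2, x\<^sub>3]\<close> is represented as the iterated polynomial ring \<open>\<complex>[x\<^sub>1][x\<^sub>2][x\<^sub>3]\<close>.\<close>

type_synonym R3 = "complex poly poly poly"

definition x1 :: R3 where "x1 = [:[:[:0, 1:]:]:]"
definition x2 :: R3 where "x2 = [:[:0, 1:]:]"
definition x3 :: R3 where "x3 = [:0, 1:]"

definition power_sum3 :: "nat \<Rightarrow> R3" where
  "power_sum3 k = x1 ^ k + x2 ^ k + x3 ^ k"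

definition f_poly :: "nat \<Rightarrow> rat poly" where
  "f_poly b = 1 + [:0, 1:] ^ b + (-1) ^ b * ([:0, 1:] + 1) ^ b"

end

theory Submission
  imports Defs "HOL-Computational_Algebra.Field_as_Ring"
begin

text \<open>
  Modulo 3 the trinomial \<open>1 + x\<^sup>b + (x + 1)\<^sup>b\<close> becomes \<open>2 (x - 1)\<^sup>b\<close>, because raising to a
  power of 3 is additive there, and its value at \<open>1\<close> is \<open>3\<close> modulo \<open>9\<close>; after the shift
  \<open>x \<mapsto> x + 1\<close> it is therefore an Eisenstein polynomial at 3.

  Since \<open>6\<close> divides \<open>b\<close>, the congruence always holds, and one has to show that the sequence is
  always regular. Setting \<open>x\<^sub>3 = - (x\<^sub>1 + x\<^sub>2)\<close> reduces this to the coprimality of two binary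
  forms. A common divisor, after substituting \<open>x\<^sub>1 x\<^sub>2\<close> for \<open>x\<^sub>2\<close>, divides a power of \<open>x\<^sub>1\<close> by a
  Bezout identity between \<open>f\<^sub>a\<close> and the irreducible \<open>f\<^sub>b\<close>; so it does not involve \<open>x\<^sub>2\<close>, and it is
  a unit because the form of degree \<open>b\<close> has leading coefficient 2 in \<open>x\<^sub>2\<close>.
\<close>

section \<open>Coefficientwise homomorphisms\<close>

lemma map_poly_add_hom:
  assumes "f 0 = 0" "\<And>x y. f (x + y) = f x + f y"
  shows "map_poly f (p + q) = map_poly f p + map_poly f q"
  by (intro poly_eqI) (simp add: assms coeff_map_poly)

lemma map_poly_mult_hom:
  fixes f :: "'a::comm_semiring_0 \<Rightarrow> 'b::comm_semiring_0"
  assumes "f 0 = 0" "\<And>x y. f (x + y) = f x + f y" "\<And>x y. f (x * y) = f x * f y"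
  shows "map_poly f (p * q) = map_poly f p * map_poly f q"
proof (induction p)
  case (pCons c p)
  then show ?case
    by (simp add: assms map_poly_pCons map_poly_add_hom map_poly_smult)
qed simp

lemma map_poly_power_hom:
  fixes f :: "'a::comm_semiring_1 \<Rightarrow> 'b::comm_semiring_1"
  assumes "f 0 = 0" "f 1 = 1" "\<And>x y. f (x + y) = f x + f y" "\<And>x y. f (x * y) = f x * f y"
  shows "map_poly f (p ^ n) = map_poly f p ^ n"
  by (induction n) (simp_all add: assms map_poly_mult_hom)

lemma pcompose_power:
  fixes p q :: "'a::comm_ring_1 poly"
  shows "pcompose (p ^ n) q = pcompose p q ^ n"
  by (induction n) (simp_all add: pcompose_1 pcompose_mult)

section \<open>Gauss's lemma and Eisenstein's criterion\<close>

lemma rat_poly_clear_denominators: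
  fixes g :: "rat poly"
  obtains m G where "m \<noteq> 0" "smult (of_int m) g = map_poly of_int G"
proof -
  have "\<exists>m G. m \<noteq> 0 \<and> smult (of_int m) g = map_poly of_int G"
  proof (induction g)
    case (pCons c p)
    then obtain m G where m: "m \<noteq> 0" and G: "smult (of_int m) p = map_poly of_int G"
      by blast
    obtain n d where nd: "quotient_of c = (n, d)"
      by fastforce
    have d: "d > 0" and c: "c = of_int n / of_int d"
      using quotient_of_denom_pos[OF nd] quotient_of_div[OF nd] by simp_all
    have "smult (of_int (d * m)) p = smult (of_int d) (map_poly of_int G)"
      by (simp flip: G)
    also have "\<dots> = map_poly of_int (smult d G)"
      by (simp add: map_poly_smult)
    finally have "smult (of_int (d * m)) (pCons c p) = map_poly of_int (pCons (m * n) (smult d G))"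
      using d by (simp add: map_poly_pCons c)
    with m d show ?case
      by (metis mult_eq_0_iff less_irrefl)
  qed (use one_neq_zero map_poly_0 smult_0_right in metis)
  then show thesis
    using that by blast
qed

text \<open>Gauss's lemma. Contents are multiplicative, so \<open>k * l\<close>, the product of the
  cleared denominators, divides the product of the contents of \<open>G\<close> and \<open>H\<close>
  and can be cancelled, leaving primitive parts and an integer \<open>e\<close>.\<close>

lemma int_poly_factorization_of_rat_poly_factorization:
  fixes f :: "int poly"
  assumes fgh: "map_poly of_int f = g * (h :: rat poly)" and "f \<noteq> 0"
  obtains G H where "f = G * H" "degree G = degree g" "degree H = degree h"
proof -
  obtain k G where k: "k \<noteq> 0" and G: "smult (of_int k) g = map_poly of_int G"
    by (rule rat_poly_clear_denominators)
  obtain l H where l: "l \<noteq> 0" and H: "smult (of_int l) h = map_poly of_int H"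
    by (rule rat_poly_clear_denominators)
  have deg: "degree G = degree g" "degree H = degree h"
    using arg_cong[OF G, of degree] arg_cong[OF H, of degree] k l
    by (simp_all add: degree_map_poly)
  have "map_poly rat_of_int (smult (k * l) f) = smult (of_int (k * l)) (g * h)"
    by (simp add: map_poly_smult fgh)
  also have "\<dots> = smult (of_int k) g * smult (of_int l) h"
    by (simp add: mult_ac)
  also have "\<dots> = map_poly of_int (G * H)"
    unfolding G H by (simp add: map_poly_mult_hom)
  finally have "map_poly rat_of_int (smult (k * l) f) = map_poly rat_of_int (G * H)" .
  then have eq: "smult (k * l) f = G * H"
    by (intro poly_eqI) (metis coeff_map_poly of_int_0 of_int_eq_iff)
  define c where "c = content G * content H"
  have "content (smult (k * l) f) = c"
    by (simp only: eq content_mult c_def)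
  then have "k * l dvd c"
    by (metis content_smult dvd_normalize_iff dvd_mult2 normalize_dvd_iff dvd_refl)
  then obtain e where e: "c = k * l * e"
    by blast
  have "smult (k * l) f = smult (content G) (primitive_part G) * smult (content H) (primitive_part H)"
    using eq by simp
  also have "\<dots> = smult c (primitive_part G * primitive_part H)"
    unfolding c_def by (simp only: mult_smult_left mult_smult_right smult_smult mult.commute)
  also have "\<dots> = smult (k * l) (smult e (primitive_part G) * primitive_part H)"
    by (simp add: e)
  finally have f: "f = smult e (primitive_part G) * primitive_part H"
    using k l by (simp add: smult_eq_iff poly_eq_iff)
  then have "e \<noteq> 0"
    using \<open>f \<noteq> 0\<close> by auto
  then show thesis
    using that[OF f] deg by simp
qed

text \<open>At the least index \<open>i\<close> with \<open>p\<close> not dividing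
  \<open>coeff g i\<close>, every term of the convolution except
  \<open>coeff g i * coeff h 0\<close> is divisible by \<open>p\<close>. Hence \<open>i\<close>
  cannot lie below \<open>degree (g * h)\<close>, although it is at most
  \<open>degree g\<close>.\<close>

lemma eisenstein_aux:
  fixes g h :: "'a::idom poly"
  assumes p: "prime_elem p"
    and lead: "\<not> p dvd lead_coeff (g * h)"
    and low: "\<And>i. i < degree (g * h) \<Longrightarrow> p dvd coeff (g * h) i"
    and g0: "p dvd coeff g 0" and h0: "\<not> p dvd coeff h 0"
  shows "degree h = 0"
proof -
  have nz: "g \<noteq> 0" "h \<noteq> 0"
    using lead by auto
  have "\<not> p dvd lead_coeff g"
    using lead by (auto simp: lead_coeff_mult)
  define i where "i = (LEAST i. \<not> p dvd coeff g i)"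
  have i: "\<not> p dvd coeff g i"
    unfolding i_def by (rule LeastI) fact
  have less: "p dvd coeff g j" if "j < i" for j
    using not_less_Least that unfolding i_def by blast
  have "i \<le> degree g"
    unfolding i_def by (rule Least_le) fact
  have "coeff (g * h) i = (\<Sum>j\<le>i. coeff g j * coeff h (i - j))"
    by (rule coeff_mult)
  also have "\<dots> = (\<Sum>j<i. coeff g j * coeff h (i - j)) + coeff g i * coeff h 0"
    by (simp flip: lessThan_Suc_atMost)
  finally have "\<not> p dvd coeff (g * h) i"
    using p i h0 dvd_sum[of "{..<i}" p "\<lambda>j. coeff g j * coeff h (i - j)"] less
    by (simp add: dvd_add_right_iff prime_elem_dvd_mult_iff)
  then have "degree (g * h) \<le> i"
    using low not_less by blast
  then show ?thesis
    using \<open>i \<le> degree g\<close> nz by (simp add: degree_mult_eq)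
qed

text \<open>Exactly one of the two integral factors has a constant coefficient divisible by
  \<open>p\<close>; the other factor is then constant by \<open>eisenstein_aux\<close>.\<close>

theorem eisenstein:
  fixes f :: "int poly"
  assumes p: "prime p"
    and lead: "\<not> p dvd lead_coeff f"
    and low: "\<And>i. i < degree f \<Longrightarrow> p dvd coeff f i"
    and const: "\<not> p\<^sup>2 dvd coeff f 0"
    and deg: "degree f > 0"
  shows "irreducible (map_poly rat_of_int f)"
proof (rule irreducibleI)
  show "map_poly rat_of_int f \<noteq> 0"
    using deg by (auto simp: map_poly_eq_0_iff)
  show "\<not> map_poly rat_of_int f dvd 1"
    using deg by (metis degree_map_poly degree_pCons_0 is_unit_poly_iff less_irrefl of_int_eq_0_iff)
next
  fix g h :: "rat poly"
  assume gh: "map_poly rat_of_int f = g * h"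
  then have "g \<noteq> 0" "h \<noteq> 0"
    using deg by (auto simp: map_poly_eq_0_iff)
  obtain G H where f: "f = G * H" and degs: "degree G = degree g" "degree H = degree h"
    using gh deg int_poly_factorization_of_rat_poly_factorization[of f g h]
    by (metis degree_0 less_irrefl)
  have pe: "prime_elem p"
    using p by (rule prime_imp_prime_elem)
  have "p dvd coeff G 0 * coeff H 0"
    using low[OF deg] by (simp add: f coeff_mult_0)
  then consider "p dvd coeff G 0" | "p dvd coeff H 0"
    using p by (auto simp: prime_dvd_mult_iff)
  then have "degree G = 0 \<or> degree H = 0"
  proof cases
    case 1
    then have "\<not> p dvd coeff H 0"
      using const by (auto simp: f coeff_mult_0 power2_eq_square intro: mult_dvd_mono)
    with 1 show ?thesis
      using eisenstein_aux[OF pe, of G H] lead low by (simp add: f)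
  next
    case 2
    then have "\<not> p dvd coeff G 0"
      using const by (auto simp: f coeff_mult_0 power2_eq_square intro: mult_dvd_mono)
    with 2 show ?thesis
      using eisenstein_aux[OF pe, of H G] lead low by (simp add: f mult.commute)
  qed
  then show "g dvd 1 \<or> h dvd 1"
    using \<open>g \<noteq> 0\<close> \<open>h \<noteq> 0\<close> by (simp add: degs is_unit_iff_degree)
qed

lemma irreducible_if_irreducible_pcompose_linear:
  fixes p :: "'a::field poly"
  assumes "irreducible (pcompose p [:c, 1:])"
  shows "irreducible p"
proof -
  have unit: "pcompose q [:c, 1:] dvd 1 \<longleftrightarrow> q dvd 1" for q :: "'a poly"
    by (cases "q = 0") (simp_all add: is_unit_iff_degree degree_pcompose pcompose_eq_0_iff)
  show ?thesis
  proof (rule irreducibleI)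
    show "p \<noteq> 0"
      using assms by auto
    show "\<not> p dvd 1"
      using assms unit irreducible_not_unit by blast
  next
    fix g h
    assume "p = g * h"
    then show "g dvd 1 \<or> h dvd 1"
      using irreducibleD[OF assms, of "pcompose g [:c, 1:]" "pcompose h [:c, 1:]"]
      by (simp add: pcompose_mult unit)
  qed
qed

section \<open>Irreducibility of the trinomial\<close>

lemma dvd_diff_power:
  fixes a b d :: "'a::comm_ring_1"
  assumes "d dvd a - b"
  shows "d dvd a ^ n - b ^ n"
  using assms by (simp add: power_diff_sumr2)

text \<open>Iterated Frobenius modulo 3, phrased as divisibility so that it covers integer
  polynomials and constants alike without a quotient ring.\<close>

lemma three_dvd_power_add_diff:
  fixes x y :: "'a::comm_ring_1"
  shows "3 dvd (x + y) ^ 3 ^ n - (x ^ 3 ^ n + y ^ 3 ^ n)"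
proof (induction n)
  case (Suc n)
  let ?X = "x ^ 3 ^ n" and ?Y = "y ^ 3 ^ n"
  have "3 dvd ((x + y) ^ 3 ^ n) ^ 3 - (?X + ?Y) ^ 3"
    using Suc by (rule dvd_diff_power)
  moreover have "(?X + ?Y) ^ 3 - (?X ^ 3 + ?Y ^ 3) = 3 * (?X ^ 2 * ?Y + ?X * ?Y ^ 2)"
    by (simp add: algebra_simps power2_eq_square power3_eq_cube)
  then have "3 dvd (?X + ?Y) ^ 3 - (?X ^ 3 + ?Y ^ 3)"
    by simp
  ultimately have "3 dvd ((x + y) ^ 3 ^ n) ^ 3 - (?X ^ 3 + ?Y ^ 3)"
    by (metis dvd_add diff_add_cancel add_diff_eq)
  then show ?case
    by (simp only: power_Suc2 power_mult)
qed simp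

lemma three_dvd_shifted_trinomial_base:
  fixes x :: "'a::comm_ring_1"
  shows "3 dvd 1 + (x + 1) ^ (3 ^ v + 1) + (x + 2) ^ (3 ^ v + 1) - 2 * x ^ (3 ^ v + 1)"
proof -
  obtain r where r: "(x + 1) ^ 3 ^ v = x ^ 3 ^ v + 1 + 3 * r"
    using three_dvd_power_add_diff[of x 1 v] by (auto simp: dvd_def algebra_simps)
  obtain s where s: "(x + 2) ^ 3 ^ v = x ^ 3 ^ v + 2 ^ 3 ^ v + 3 * s"
    using three_dvd_power_add_diff[of x 2 v] by (auto simp: dvd_def algebra_simps)
  obtain t where t: "(2 :: 'a) ^ 3 ^ v = 2 + 3 * t"
    using three_dvd_power_add_diff[of "1 :: 'a" 1 v] by (auto simp: dvd_def algebra_simps)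
  \<comment> \<open>With \<open>q = 3 ^ v\<close>, the sum
    \<open>1 + (x ^ q + 1) * (x + 1) + (x ^ q + 2) * (x + 2)\<close> has coefficients 3, 3 and 6 at
    \<open>x ^ q\<close>, \<open>x\<close> and 1.\<close>
  have "1 + (x + 1) ^ (3 ^ v + 1) + (x + 2) ^ (3 ^ v + 1) - 2 * x ^ (3 ^ v + 1) =
    3 * (2 + x ^ 3 ^ v + x + r * (x + 1) + (s + t) * (x + 2))"
    unfolding power_add power_one_right r s t by (simp add: algebra_simps)
  then show ?thesis
    by (rule dvdI)
qed

text \<open>The base congruence is raised to the power \<open>3 ^ u\<close>, which is additive
  modulo 3; fact \<open>4\<close> reduces \<open>2 ^ 3 ^ u\<close> to 2.\<close>

lemma three_dvd_shifted_trinomial: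
  fixes x :: "'a::comm_ring_1"
  assumes b: "b = 3 ^ u * (3 ^ v + 1)"
  shows "3 dvd 1 + (x + 1) ^ b + (x + 2) ^ b - 2 * x ^ b"
proof -
  let ?q = "(3::nat) ^ v + 1" and ?w = "(3::nat) ^ u"
  let ?y = "(x + 1) ^ ?q" and ?z = "(x + 2) ^ ?q"
  have pow: "c ^ b = (c ^ ?q) ^ ?w" for c :: 'a
    by (simp only: b mult.commute[of ?w] power_mult)
  have 1: "3 dvd (1 + ?y + ?z) ^ ?w - ((1 + ?y) ^ ?w + ?z ^ ?w)"
    by (rule three_dvd_power_add_diff)
  have 2: "3 dvd (1 + ?y) ^ ?w - (1 ^ ?w + ?y ^ ?w)"
    by (rule three_dvd_power_add_diff)
  have 3: "3 dvd (1 + ?y + ?z) ^ ?w - (2 * x ^ ?q) ^ ?w"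
    by (rule dvd_diff_power) (rule three_dvd_shifted_trinomial_base)
  have 4: "3 dvd (1 + 1 :: 'a) ^ ?w - (1 ^ ?w + 1 ^ ?w)"
    by (rule three_dvd_power_add_diff)
  have 5: "(2 * x ^ ?q) ^ ?w = (1 + 1) ^ ?w * (x ^ ?q) ^ ?w"
    by (simp only: power_mult_distrib one_add_one)
  have "1 + (x + 1) ^ b + (x + 2) ^ b - 2 * x ^ b =
    ((1 + ?y + ?z) ^ ?w - (2 * x ^ ?q) ^ ?w) - ((1 + ?y + ?z) ^ ?w - ((1 + ?y) ^ ?w + ?z ^ ?w))
    - ((1 + ?y) ^ ?w - (1 ^ ?w + ?y ^ ?w)) + ((1 + 1) ^ ?w - (1 ^ ?w + 1 ^ ?w)) * (x ^ ?q) ^ ?w"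
    unfolding pow 5 power_one by (simp only: one_add_one left_diff_distrib) simp
  also have "3 dvd \<dots>"
    by (intro dvd_add dvd_diff dvd_mult2 1 2 3 4)
  finally show ?thesis .
qed

lemma six_dvd_exponent:
  fixes u v :: nat
  assumes "u > 0"
  shows "6 dvd (3::nat) ^ u * (3 ^ v + 1)"
proof -
  have "3 * 2 dvd (3::nat) ^ u * (3 ^ v + 1)"
    using assms by (intro mult_dvd_mono) (auto simp: dvd_power)
  then show ?thesis
    by simp
qed

lemma irreducible_f_poly:
  assumes "u > 0" and b: "b = 3 ^ u * (3 ^ v + 1)"
  shows "irreducible (f_poly b)"
proof -
  obtain k where k: "b = 6 * k"
    using six_dvd_exponent[OF \<open>u > 0\<close>, of v] b by blast
  have "b > 0"
    using b by simp
  \<comment> \<open>This is \<open>f_poly b\<close> shifted by 1, with integer coefficients; the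
    sign is gone because \<open>b\<close> is even.\<close>
  define F :: "int poly" where "F = 1 + [:1, 1:] ^ b + [:2, 1:] ^ b"
  have "[:0, 1:] + 1 = [:1, 1::int:]" "[:0, 1:] + 2 = [:2, 1::int:]"
    by (simp_all add: one_pCons numeral_poly)
  then have "3 dvd F - 2 * [:0, 1:] ^ b"
    using three_dvd_shifted_trinomial[OF b, of "[:0, 1::int:]"] by (simp add: F_def)
  then have "[:3:] dvd F - monom 2 b"
    by (simp add: numeral_poly monom_altdef)
  then have cong: "3 dvd coeff F i - (if i = b then 2 else 0)" for i
    by (auto simp: const_poly_dvd_iff dest!: spec[of _ i])
  have deg: "degree F = b"
  proof (rule antisym)
    show "degree F \<le> b"
      unfolding F_def by (intro degree_add_le) (simp_all add: degree_linear_power)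
    show "b \<le> degree F"
      using cong[of b] by (intro le_degree) auto
  qed
  \<comment> \<open>The last summand is \<open>2 ^ b = 64 ^ k\<close>. As 64 is 1 modulo 9, the
    constant coefficient is 3 modulo 9.\<close>
  have "coeff F 0 = 2 + 64 ^ k"
    by (simp add: F_def coeff_0_power k power_mult)
  moreover have "[64 ^ k = 1 ^ k] (mod (9::int))"
    by (rule cong_pow) (simp add: cong_def)
  ultimately have const: "\<not> 3\<^sup>2 dvd coeff F 0"
    by (simp add: cong_def) presburger
  have "irreducible (map_poly rat_of_int F)"
  proof (rule eisenstein)
    show "\<not> 3 dvd lead_coeff F"
      using cong[of b] deg by presburger
    show "3 dvd coeff F i" if "i < degree F" for i
      using cong[of i] that deg by simp
  qed (use const deg \<open>b > 0\<close> in simp_all)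
  also have "map_poly rat_of_int F = pcompose (f_poly b) [:1, 1:]"
  proof -
    have "[:0, 1:] + 1 = [:1, 1::rat:]"
      by (simp add: one_pCons)
    then have "f_poly b = 1 + [:0, 1:] ^ b + [:1, 1:] ^ b"
      by (simp add: f_poly_def k)
    then show ?thesis
      by (simp add: F_def map_poly_add_hom map_poly_power_hom map_poly_pCons
          pcompose_add pcompose_power pcompose_1 pcompose_pCons)
  qed
  finally show ?thesis
    by (rule irreducible_if_irreducible_pcompose_linear)
qed

text \<open>An irreducible polynomial of degree at least \<open>b\<close> cannot divide a nonzero
  one of degree at most \<open>a < b\<close>.\<close>

lemma coprime_f_poly:
  assumes irr: "irreducible (f_poly b)" and "even b" "1 < a" "a < b"
  shows "coprime (f_poly b) (f_poly a)"
proof -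
  have X1: "[:0, 1:] + 1 = [:1, 1::rat:]"
    by (simp add: one_pCons)
  have "coeff (f_poly b) b \<noteq> 0"
    using \<open>even b\<close> \<open>a < b\<close>
    by (simp add: f_poly_def X1 coeff_linear_power)
  then have "degree (f_poly b) \<ge> b"
    by (rule le_degree)
  moreover have "degree (f_poly a) \<le> a"
  proof -
    have "degree ((-1) ^ a * [:1, 1::rat:] ^ a) \<le> a"
      by (cases "even a") (simp_all add: degree_linear_power)
    then show ?thesis
      unfolding f_poly_def X1 by (intro degree_add_le) (simp_all add: degree_linear_power)
  qed
  moreover have "f_poly a \<noteq> 0"
  proof
    assume "f_poly a = 0"
    \<comment> \<open>The value at 1 is \<open>2 + (-2) ^ a\<close>, which is nonzero for
      \<open>a > 1\<close>.\<close>
    then have "poly (f_poly a) 1 = 0"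
      by simp
    moreover have "(2::rat) ^ a \<ge> 2 ^ 2"
      using \<open>1 < a\<close> by (intro power_increasing) auto
    ultimately show False
      by (cases "even a") (simp_all add: f_poly_def)
  qed
  ultimately have "\<not> f_poly b dvd f_poly a"
    using dvd_imp_degree_le[of "f_poly b" "f_poly a"] \<open>a < b\<close> by linarith
  with irr show ?thesis
    by (intro prime_elem_imp_coprime irreducible_imp_prime_elem_gcd)
qed

section \<open>Regular sequences\<close>

lemma ideal_generated_empty: "ideal_generated {} = {0}"
  by (simp add: ideal_generated_def module.span_empty[OF module_times])

lemma ideal_generated_insert:
  "x \<in> ideal_generated (insert a S) \<longleftrightarrow> (\<exists>k. x - k * a \<in> ideal_generated S)"
  by (simp add: ideal_generated_def module.span_breakdown_eq[OF module_times])

lemma regular_sequence_3: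
  "regular_sequence [p, q, r] \<longleftrightarrow>
    ideal_generated {p, q, r} \<noteq> UNIV \<and>
    (\<forall>g. g * p \<in> ideal_generated {} \<longrightarrow> g \<in> ideal_generated {}) \<and>
    (\<forall>g. g * q \<in> ideal_generated {p} \<longrightarrow> g \<in> ideal_generated {p}) \<and>
    (\<forall>g. g * r \<in> ideal_generated {p, q} \<longrightarrow> g \<in> ideal_generated {p, q})"
  by (simp add: regular_sequence_def All_less_Suc numeral_3_eq_3 insert_commute) blast

lemma ideal_generated_linear:
  fixes c :: "'a::idom"
  shows "x \<in> ideal_generated {[:- c, 1:]} \<longleftrightarrow> poly x c = 0"
  by (auto simp: ideal_generated_insert ideal_generated_empty poly_eq_0_iff_dvd dvd_def mult.commute)

text \<open>Evaluation at \<open>c\<close> identifies the quotient by \<open>[:- c, 1:]\<close> with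
  the coefficient ring. For the converse direction, a quotient there is lifted to a constant
  polynomial.\<close>

lemma ideal_generated_linear_insert:
  fixes c :: "'a::idom"
  shows "x \<in> ideal_generated {[:- c, 1:], q} \<longleftrightarrow> poly q c dvd poly x c"
proof -
  have "x \<in> ideal_generated {q, [:- c, 1:]} \<longleftrightarrow> (\<exists>k. poly x c = poly k c * poly q c)"
    by (subst ideal_generated_insert) (simp add: ideal_generated_linear)
  also have "\<dots> \<longleftrightarrow> poly q c dvd poly x c"
    by (metis dvdE dvd_triv_right mult.commute poly_0 poly_pCons add_0_right mult_zero_right)
  finally show ?thesis
    by (simp add: insert_commute)
qed

text \<open>After evaluation at \<open>c\<close>, the condition on \<open>q\<close> is cancellation
  in a domain, and the condition on \<open>r\<close> is Euclid's lemma for coprime elements.\<close>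

lemma regular_sequence_linear:
  fixes c :: "'a::{idom, semiring_gcd}"
  assumes proper: "ideal_generated {[:- c, 1:], q, r} \<noteq> UNIV"
    and "poly q c \<noteq> 0" and "coprime (poly q c) (poly r c)"
  shows "regular_sequence [[:- c, 1:], q, r]"
proof -
  have "[:- c, 1:] \<noteq> 0"
    by simp
  then have "g = 0" if "g * [:- c, 1:] = 0" for g
    using that by (metis mult_eq_0_iff)
  then show ?thesis
    using assms
    unfolding regular_sequence_3 ideal_generated_linear ideal_generated_linear_insert
      ideal_generated_empty
    by (simp add: coprime_dvd_mult_left_iff coprime_commute)
qed

text \<open>A ring homomorphism killing all generators would send 1 to 0.\<close>

lemma ideal_generated_ne_UNIV:
  fixes \<phi> :: "'a::comm_ring_1 \<Rightarrow> 'b::comm_ring_1"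
  assumes "\<phi> 1 = 1" "\<And>x y. \<phi> (x + y) = \<phi> x + \<phi> y" "\<And>x y. \<phi> (x * y) = \<phi> x * \<phi> y"
    and "\<phi> p = 0" "\<phi> q = 0" "\<phi> r = 0"
  shows "ideal_generated {p, q, r} \<noteq> UNIV"
proof
  assume "ideal_generated {p, q, r} = UNIV"
  then have "1 \<in> ideal_generated {p, q, r}"
    by simp
  then obtain k l m where "1 = k * p + l * q + m * r"
    by (auto simp: ideal_generated_insert ideal_generated_empty algebra_simps)
  then have "\<phi> 1 = \<phi> (k * p + l * q + m * r)"
    by simp
  then show False
    by (simp add: assms)
qed

section \<open>Power sums in three variables\<close>

text \<open>The image of the \<open>k\<close>-th power sum under \<open>x\<^sub>3 := - (x\<^sub>1 + x\<^sub>2)\<close>, an element of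
  \<open>\<complex>[x\<^sub>1][x\<^sub>2]\<close>.\<close>

definition power_sum_elim :: "nat \<Rightarrow> complex poly poly" where
  "power_sum_elim k = [:[:0, 1:]:] ^ k + [:0, 1:] ^ k + (- [:[:0, 1:], 1:]) ^ k"

text \<open>The double negation gives the shape \<open>[:- c, 1:]\<close> with \<open>c\<close> the
  polynomial \<open>-(x1 + x2)\<close>, as \<open>regular_sequence_linear\<close> expects.\<close>

lemma power_sum3_1: "power_sum3 1 = [:- (- [:[:0, 1:], 1:]), 1:]"
  by (simp add: power_sum3_def x1_def x2_def x3_def)

lemma poly_power_sum3: "poly (power_sum3 k) (- [:[:0, 1:], 1:]) = power_sum_elim k"
  by (simp add: power_sum3_def x1_def x2_def x3_def power_sum_elim_def poly_power)

lemma power_sum_elim_nonzero: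
  assumes "1 < a"
  shows "power_sum_elim a \<noteq> 0"
proof
  assume "power_sum_elim a = 0"
  then have "poly (poly (power_sum_elim a) 1) 1 = 0"
    by simp
  then have "2 + (- 2) ^ a = (0 :: complex)"
    by (simp add: power_sum_elim_def poly_power)
  then have "(- 2) ^ a = (- 2 :: complex)"
    by (simp add: add_eq_0_iff)
  then have "(2::real) ^ a = 2"
    by (metis norm_minus_cancel norm_numeral norm_power)
  moreover have "(2::real) ^ a \<ge> 2 ^ 2"
    using assms by (intro power_increasing) auto
  ultimately show False
    by simp
qed

text \<open>The variable becomes the outer one, \<open>x2\<close>; rational coefficients become
  constants in \<open>x1\<close>.\<close>

definition lift_poly :: "rat poly \<Rightarrow> complex poly poly" where
  "lift_poly = map_poly (\<lambda>c. [:of_rat c:])"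

lemma lift_poly_simps:
  "lift_poly 1 = 1" "lift_poly (p + q) = lift_poly p + lift_poly q"
  "lift_poly (p * q) = lift_poly p * lift_poly q" "lift_poly (p ^ n) = lift_poly p ^ n"
  "lift_poly [:0, 1:] = [:0, 1:]" "lift_poly (- 1) = - 1"
  by (simp_all add: lift_poly_def map_poly_add_hom map_poly_mult_hom map_poly_power_hom
      map_poly_pCons of_rat_add of_rat_mult of_rat_minus one_pCons)

text \<open>Dehomogenization: replacing \<open>x2\<close> by \<open>x1 * x2\<close> in a form of
  degree \<open>k\<close> splits off \<open>x1 ^ k\<close>.\<close>

lemma pcompose_power_sum_elim:
  "pcompose (power_sum_elim k) [:0, [:0, 1:]:] = [:[:0, 1:]:] ^ k * lift_poly (f_poly k)"
proof -
  have "pcompose [:0, 1:] [:0, [:0, 1:]:] = [:[:0, 1:]:] * [:0, 1::complex poly:]"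
    by (simp add: pcompose_pCons)
  moreover have "pcompose (- [:[:0, 1:], 1:]) [:0, [:0, 1:]:] =
    [:[:0, 1:]:] * (- 1 * ([:0, 1::complex poly:] + 1))"
    by (simp add: pcompose_pCons pcompose_uminus one_pCons)
  ultimately show ?thesis
    unfolding power_sum_elim_def f_poly_def pcompose_add pcompose_power pcompose_const lift_poly_simps
    by (simp only: power_mult_distrib) (simp only: distrib_left mult_1_right)
qed

lemma coprime_power_sum_elim:
  assumes cop: "coprime (f_poly b) (f_poly a)" and "even b" "a \<le> b" "b > 0"
  shows "coprime (power_sum_elim a) (power_sum_elim b)"
proof (rule coprimeI)
  fix d
  assume da: "d dvd power_sum_elim a" and db: "d dvd power_sum_elim b"
  let ?s = "[:0, [:0, 1:]:] :: complex poly poly" and ?x = "[:[:0, 1:]:] :: complex poly poly"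
  have dvd: "pcompose d ?s dvd ?x ^ b * lift_poly (f_poly k)"
    if "d dvd power_sum_elim k" "k \<le> b" for k
  proof -
    have "pcompose d ?s dvd ?x ^ k * lift_poly (f_poly k)"
      using that(1) by (metis dvdE dvd_triv_left pcompose_mult pcompose_power_sum_elim)
    also have "\<dots> dvd ?x ^ b * lift_poly (f_poly k)"
      using that(2) by (intro mult_dvd_mono le_imp_power_dvd) simp_all
    finally show ?thesis .
  qed
  obtain r s where rs: "r * f_poly b + s * f_poly a = 1"
    using bezout_coefficients_fst_snd[of "f_poly b" "f_poly a"] cop by auto
  have "pcompose d ?s dvd
    lift_poly r * (?x ^ b * lift_poly (f_poly b)) + lift_poly s * (?x ^ b * lift_poly (f_poly a))"
    using dvd_mult[OF dvd[OF db order.refl]] dvd_mult[OF dvd[OF da \<open>a \<le> b\<close>]]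
    by (rule dvd_add)
  also have "\<dots> = ?x ^ b * lift_poly (r * f_poly b + s * f_poly a)"
    by (simp only: lift_poly_simps) algebra
  also have "\<dots> = [:[:0, 1:] ^ b:]"
    by (simp add: rs lift_poly_simps poly_const_pow)
  \<comment> \<open>The right-hand side is constant in \<open>x2\<close>, and the substitution
    preserves the degree in \<open>x2\<close>.\<close>
  finally have "degree (pcompose d ?s) \<le> degree [:[:0, 1:] ^ b :: complex poly:]"
    by (rule dvd_imp_degree_le) simp
  then have "degree d = 0"
    by (simp add: degree_pcompose)
  then obtain e where d: "d = [:e:]"
    by (rule degree_eq_zeroE)
  \<comment> \<open>For even \<open>b > 0\<close>, both \<open>x2 ^ b\<close> and
    \<open>(x1 + x2) ^ b\<close> contribute 1, while \<open>x1 ^ b\<close> contributes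
    nothing.\<close>
  have "coeff (power_sum_elim b) b = 2"
    using \<open>even b\<close> \<open>b > 0\<close>
    by (simp add: power_sum_elim_def poly_const_pow coeff_linear_power coeff_pCons
        split: nat.split)
  moreover have "e dvd coeff (power_sum_elim b) b"
    using db by (simp add: d const_poly_dvd_iff)
  moreover have "(2 :: complex poly) dvd 1"
    by (simp add: numeral_poly is_unit_const_poly_iff dvd_field_iff)
  ultimately have "e dvd 1"
    by (metis dvd_trans)
  then show "d dvd 1"
    by (simp add: d is_unit_const_poly_iff)
qed

text \<open>Evaluation at the origin annihilates every power sum of positive degree.\<close>

lemma ideal_generated_power_sums_ne_UNIV:
  assumes "i > 0" "j > 0" "k > 0"
  shows "ideal_generated {power_sum3 i, power_sum3 j, power_sum3 k} \<noteq> UNIV"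
proof -
  have "poly (poly (poly (power_sum3 n) 0) 0) 0 = 0" if "n > 0" for n
    using that by (simp add: power_sum3_def x1_def x2_def x3_def poly_power)
  with assms show ?thesis
    by (intro ideal_generated_ne_UNIV[where \<phi> = "\<lambda>p. poly (poly (poly p 0) 0) 0"]) simp_all
qed

theorem mainTheorem5:
  fixes u v b :: nat
  assumes "u > 0"
    and "b = 3 ^ u * (3 ^ v + 1)"
  shows "irreducible (f_poly b) \<and>
    (\<forall>a::nat. 1 < a \<and> a < b \<longrightarrow>
       (regular_sequence [power_sum3 1, power_sum3 a, power_sum3 b] \<longleftrightarrow> [a * b = 0] (mod 6)))"
proof (intro conjI allI impI)
  show irr: "irreducible (f_poly b)"
    using assms by (rule irreducible_f_poly)
  fix a :: nat
  assume a: "1 < a \<and> a < b"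
  have "6 dvd b"
    using six_dvd_exponent assms by simp
  then have "[a * b = 0] (mod 6)"
    by (simp add: cong_0_iff)
  moreover have "even b"
    using \<open>6 dvd b\<close> by (auto elim: dvd_trans[rotated])
  have "regular_sequence [power_sum3 1, power_sum3 a, power_sum3 b]"
    unfolding power_sum3_1
  proof (rule regular_sequence_linear, unfold poly_power_sum3, fold power_sum3_1)
    show "ideal_generated {power_sum3 1, power_sum3 a, power_sum3 b} \<noteq> UNIV"
      using a by (intro ideal_generated_power_sums_ne_UNIV) auto
    show "power_sum_elim a \<noteq> 0"
      using a by (simp add: power_sum_elim_nonzero)
    show "coprime (power_sum_elim a) (power_sum_elim b)"
      using coprime_f_poly[OF irr \<open>even b\<close>] a \<open>even b\<close> by (intro coprime_power_sum_elim) auto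
  qed
  ultimately show
    "regular_sequence [power_sum3 1, power_sum3 a, power_sum3 b] \<longleftrightarrow> [a * b = 0] (mod 6)"
    by blast
qed

end
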